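(* Let $\{x(k)\}_{k\in\mathbb{N}}$ be the sequence of points produced either by the exact asynchronous algorithm or by the asynchronous algorithm with the gradient-step update (both defined in the context), where node $i$ is activated with probability $P_i>0$. Let $\mathcal{X}^\star=\{x^\star : \hat f(x^\star)=\hat f^\star\}$ be the set of minimizers of $\hat f$. Then $$\lim_{k\to\infty}\mathrm{d}_{\mathcal{X}^\star}\bigl(x(k)\bigr)=0\quad\text{almost surely.}$$
   Context: Network. Let $\mathcal{G}=(\mathcal{V},\mathcal{E})$ be a finite undirected simple graph with $\mathcal{V}=\{1,\dots,n\}$ (sensors); write $i\sim j$ for an edge. Let $p\in\{2,3\}$, let $\mathcal{A}=\{1,\dots,m\}$ be a set of anchors with known positions $a_k\in\mathbb{R}^p$, and for each $i\in\mathcal{V}$ let $\mathcal{A}_i\subset\mathcal{A}$ be the (possibly empty) set of anchors linked to sensor $i$. For each edge $i\sim j$ a measurement $d_{ij}=d_{ji}\ge 0$ is given, and for each $i\in\mathcal{V}$, $k\in\mathcal{A}_i$ a measurement $r_{ik}\ge 0$ is given. Standing assumption: there is at least one anchor linked to some sensor (some $\mathcal{A}_i\neq\emptyset$), and $\mathcal{G}$ is connected. Cost function. For a nonempty set $C$, $\mathrm{d}_C(x)=\inf_{y\in C}\|x-y\|$ (Euclidean norm) and $\mathrm{d}_C^2(x)=(\mathrm{d}_C(x))^2$. Let $\mathrm{B}_{ij}=\{z\in\mathbb{R}^p:\|z\|\le d_{ij}\}$ and $\mathrm{Ba}_{ik}=\{z\in\mathbb{R}^p:\|z-a_k\|\le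 r_{ik}\}$. For $x=(x_1,\dots,x_n)\in(\mathbb{R}^p)^n$ define $$\hat f(x)=\sum_{i\sim j}\tfrac12\,\mathrm{d}^2_{\mathrm{B}_{ij}}(x_i-x_j)+\sum_{i\in\mathcal{V}}\sum_{k\in\mathcal{A}_i}\tfrac12\,\mathrm{d}^2_{\mathrm{Ba}_{ik}}(x_i),$$ each edge being counted once. The function $\hat f$ is convex and differentiable; $\nabla_i\hat f$ denotes its gradient with respect to $x_i$. Put $\hat f^\star=\inf_x\hat f(x)$. Let $L_{\hat f}=2\delta_{\max}+\max_{i\in\mathcal{V}}|\mathcal{A}_i|$, where $\delta_{\max}$ is the maximum node degree of $\mathcal{G}$. Asynchronous algorithm. Let $\{\xi_k\}_{k\ge1}$ be independent random variables with values in $\mathcal{V}$ and $\mathbb{P}(\xi_k=i)=P_i>0$ for all $i\in\mathcal{V}$ and all $k$ (so $\sum_iP_i=1$). The initial point $x(0)$ is arbitrary, possibly random, independent of $\{\xi_k\}$. At iteration $k\ge1$, if $\xi_k=i$, then $x_j(k)=x_j(k-1)$ for all $j\ne i$, and $x_i(k)$ is given by: (exact algorithm) $x_i(k)\in\operatorname{argmin}_{w\in\mathbb{R}^p}\hat f\bigl(x_1(k-1),\dots,x_{i-1}(k-1),w,x_{i+1}(k-1),\dots,x_n(k-1)\bigr)$, where if the minimizer is not unique any one is chosen (measurably, and without using the future activations $\xi_{k+1},\xi_{k+2},\dots$); (algorithm with gradient-step update) $x_i(k)=x_i(k-1)-\frac{1}{L_{\hat f}}\nabla_i\hat f(x(k-1))$.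 *)

theory Defs
  imports "HOL-Probability.Probability"
begin

text \<open>
  Sensors are the elements of a finite type \<open>'n\<close>, anchors those of \<open>'m\<close>, and a configuration of
  all sensors is a vector \<open>x :: (real ^ 'p) ^ 'n\<close>, whose norm is the Euclidean norm of
  \<open>(\<real>\<^sup>p)\<^sup>n\<close>. The order on \<open>'n\<close> (that of \<open>{1,\<dots>,n}\<close>) serves only to count each
  undirected edge once.
\<close>

definition network_cost ::
  "('n::{finite,linorder} \<Rightarrow> 'n \<Rightarrow> bool) \<Rightarrow> ('n \<Rightarrow> 'n \<Rightarrow> real) \<Rightarrow>
   ('n \<Rightarrow> 'm::finite set) \<Rightarrow> ('m \<Rightarrow> real ^ 'p) \<Rightarrow> ('n \<Rightarrow> 'm \<Rightarrow> real) \<Rightarrow>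
   (real ^ 'p::finite) ^ 'n::{finite,linorder} \<Rightarrow> real" where
  "network_cost adj d A a r x =
     (\<Sum>(i, j) \<in> {(i, j). i < j \<and> adj i j}. 1/2 * (infdist (x $ i - x $ j) (cball 0 (d i j)))\<^sup>2)
   + (\<Sum>i\<in>UNIV. \<Sum>k\<in>A i. 1/2 * (infdist (x $ i) (cball (a k) (r i k)))\<^sup>2)"

definition lipschitz_const ::
  "('n::finite \<Rightarrow> 'n \<Rightarrow> bool) \<Rightarrow> ('n \<Rightarrow> 'm::finite set) \<Rightarrow> real" where
  "lipschitz_const adj A =
     real (2 * Max (range (\<lambda>i. card {j. adj i j})) + Max (range (\<lambda>i. card (A i))))"

definition minimizers :: "('x \<Rightarrow> real) \<Rightarrow> 'x set" where
  "minimizers f = {x. f x = (INF y. f y)}"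

definition block_update :: "'b ^ 'n::finite \<Rightarrow> 'n \<Rightarrow> 'b \<Rightarrow> 'b ^ 'n" where
  "block_update x i w = (\<chi> j. if j = i then w else x $ j)"

definition block_gradient ::
  "('b::real_inner ^ 'n::finite \<Rightarrow> real) \<Rightarrow> 'n \<Rightarrow> 'b ^ 'n \<Rightarrow> 'b" where
  "block_gradient f i x = (THE D. GDERIV (\<lambda>w. f (block_update x i w)) (x $ i) :> D)"

definition exact_update ::
  "('b ^ 'n::finite \<Rightarrow> real) \<Rightarrow> 'n \<Rightarrow> 'b ^ 'n \<Rightarrow> 'b ^ 'n \<Rightarrow> bool" where
  "exact_update f i x y \<longleftrightarrow>
     (\<forall>j. j \<noteq> i \<longrightarrow> y $ j = x $ j) \<and>
     is_arg_min (\<lambda>w. f (block_update x i w)) (\<lambda>_. True) (y $ i)"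

definition gradient_update ::
  "('b::real_inner ^ 'n::finite \<Rightarrow> real) \<Rightarrow> real \<Rightarrow> 'n \<Rightarrow> 'b ^ 'n \<Rightarrow> 'b ^ 'n \<Rightarrow> bool" where
  "gradient_update f L i x y \<longleftrightarrow>
     (\<forall>j. j \<noteq> i \<longrightarrow> y $ j = x $ j) \<and>
     y $ i = x $ i - (1 / L) *\<^sub>R block_gradient f i x"

text \<open>
  The activations are indexed from 1: the step from \<open>x k\<close> to \<open>x (Suc k)\<close> uses \<open>\<xi> (Suc k)\<close>, so
  \<open>\<xi> 0\<close> is never used.
\<close>

definition exact_async ::
  "'w measure \<Rightarrow> ('b ^ 'n::finite \<Rightarrow> real) \<Rightarrow> (nat \<Rightarrow> 'w \<Rightarrow> 'n) \<Rightarrow> (nat \<Rightarrow> 'w \<Rightarrow> 'b ^ 'n) \<Rightarrow> bool" where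
  "exact_async M f \<xi> x \<longleftrightarrow>
     (\<forall>\<omega>\<in>space M. \<forall>k. exact_update f (\<xi> (Suc k) \<omega>) (x k \<omega>) (x (Suc k) \<omega>))"

definition gradient_async ::
  "'w measure \<Rightarrow> ('b::real_inner ^ 'n::finite \<Rightarrow> real) \<Rightarrow> real \<Rightarrow> (nat \<Rightarrow> 'w \<Rightarrow> 'n) \<Rightarrow>
   (nat \<Rightarrow> 'w \<Rightarrow> 'b ^ 'n) \<Rightarrow> bool" where
  "gradient_async M f L \<xi> x \<longleftrightarrow>
     (\<forall>\<omega>\<in>space M. \<forall>k. gradient_update f L (\<xi> (Suc k) \<omega>) (x k \<omega>) (x (Suc k) \<omega>))"

text \<open>
  The library's \<open>indep_var\<close> requires both random variables to have the same codomain type; this is the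
  same notion (independence of the generated sigma-algebras) without that restriction.
\<close>

definition indep_rvs ::
  "'w measure \<Rightarrow> 'b measure \<Rightarrow> ('w \<Rightarrow> 'b) \<Rightarrow> 'c measure \<Rightarrow> ('w \<Rightarrow> 'c) \<Rightarrow> bool" where
  "indep_rvs M S X T Y \<longleftrightarrow>
     X \<in> measurable M S \<and> Y \<in> measurable M T \<and>
     prob_space.indep_set M (sets (vimage_algebra (space M) X S)) (sets (vimage_algebra (space M) Y T))"

text \<open>
  The iterates do not use future activations: for every \<open>k\<close>, the pair consisting of the iterates
  \<open>x 0, \<dots>, x k\<close> and the activations \<open>\<xi> 1, \<dots>, \<xi> k\<close> is measurable and independent of the
  whole sequence \<open>\<xi> (k+1), \<xi> (k+2), \<dots>\<close>. This covers any measurable selection that is a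
  function of the past, and also selections randomized independently of the activations.
\<close>

definition nonanticipative ::
  "'w measure \<Rightarrow> (nat \<Rightarrow> 'w \<Rightarrow> 'n) \<Rightarrow> (nat \<Rightarrow> 'w \<Rightarrow> 'x::topological_space) \<Rightarrow> bool" where
  "nonanticipative M \<xi> x \<longleftrightarrow>
     (\<forall>k. indep_rvs M
        ((\<Pi>\<^sub>M j\<in>{..k}. borel) \<Otimes>\<^sub>M (\<Pi>\<^sub>M j\<in>{1..k}. count_space UNIV))
        (\<lambda>\<omega>. (\<lambda>j\<in>{..k}. x j \<omega>, \<lambda>j\<in>{1..k}. \<xi> j \<omega>))
        (\<Pi>\<^sub>M j\<in>{k<..}. count_space UNIV)
        (\<lambda>\<omega>. \<lambda>j\<in>{k<..}. \<xi> j \<omega>))"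

end

theory Submission
  imports Defs
begin

text \<open>
  The cost is convex with a continuous gradient \<open>G\<close>, and along block \<open>i\<close> it is \<open>L\<close>-smooth, so a step
  at block \<open>i\<close> of either kind lowers it by at least \<open>\<parallel>G\<^sub>i\<parallel>\<^sup>2 / (2 L)\<close>. Hence the squared gradients of the
  activated blocks are summable along every trajectory. Since the next activation is independent of the
  current iterate and each block has positive probability, the squared gradients of all blocks are
  almost surely summable, so \<open>G (x k)\<close> tends to 0. The sublevel sets of the cost are compact and a
  zero of \<open>G\<close> is a minimizer, so the iterates approach the set of minimizers.
\<close>

subsection \<open>Squared distance to a convex set\<close>

text \<open>For closed convex nonempty \<open>C\<close> this is the gradient at \<open>z\<close> of
  half the squared distance to \<open>C\<close>; the upper and lower bounds below encode that
  without differentiating anything.\<close>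

definition residual :: "'a::euclidean_space set \<Rightarrow> 'a \<Rightarrow> 'a" where
  "residual C z = z - closest_point C z"

lemma infdist_eq_norm_residual:
  assumes "closed C" "C \<noteq> {}"
  shows "infdist z C = norm (residual C z)"
proof (rule antisym)
  show "infdist z C \<le> norm (residual C z)"
    unfolding residual_def using infdist_le[OF closest_point_in_set[OF assms]]
    by (metis dist_norm)
  obtain q where "q \<in> C" "infdist z C = dist z q"
    using infdist_attains_inf[OF assms] by metis
  then show "norm (residual C z) \<le> infdist z C"
    unfolding residual_def using closest_point_le[OF assms(1)] by (metis dist_norm)
qed

text \<open>The closest point to \<open>z\<close> is still a competitor for \<open>w\<close>, so
  \<open>infdist w C\<close> is at most the norm of \<open>residual C z + (w - z)\<close>; squaring
  and expanding gives the bound.\<close>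

lemma half_sq_infdist_upper:
  assumes "closed C" "C \<noteq> {}"
  shows "1/2 * (infdist w C)\<^sup>2
    \<le> 1/2 * (infdist z C)\<^sup>2 + residual C z \<bullet> (w - z) + 1/2 * (norm (w - z))\<^sup>2"
proof -
  have "infdist w C \<le> norm (residual C z + (w - z))"
    using infdist_le[OF closest_point_in_set[OF assms, of z], of w]
    by (simp add: residual_def dist_norm)
  then have "(infdist w C)\<^sup>2 \<le> (norm (residual C z + (w - z)))\<^sup>2"
    by (simp add: power_mono infdist_nonneg)
  then show ?thesis
    unfolding infdist_eq_norm_residual[OF assms]
    by (simp add: power2_norm_eq_inner inner_add_left inner_add_right inner_commute algebra_simps)
qed

text \<open>The obtuse angle property of the projection bounds \<open>e \<bullet> (w - z)\<close> by
  \<open>e \<bullet> u - e \<bullet> e\<close>, and the square of \<open>u - e\<close> being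
  nonnegative absorbs the mixed term.\<close>

lemma half_sq_infdist_lower:
  assumes "closed C" "convex C" "C \<noteq> {}"
  shows "1/2 * (infdist z C)\<^sup>2 + residual C z \<bullet> (w - z) \<le> 1/2 * (infdist w C)\<^sup>2"
proof -
  define e u where "e = residual C z" and "u = residual C w"
  have obtuse: "e \<bullet> (closest_point C w - closest_point C z) \<le> 0"
    unfolding e_def residual_def
    by (rule closest_point_dot[OF assms(2,1) closest_point_in_set[OF assms(1,3)]])
  have "w - z = u - e + (closest_point C w - closest_point C z)"
    by (simp add: e_def u_def residual_def)
  then have "e \<bullet> (w - z) \<le> e \<bullet> u - e \<bullet> e"
    using obtuse by (simp add: inner_add_right inner_diff_right)
  moreover have "0 \<le> (u - e) \<bullet> (u - e)"
    by simp
  ultimately show ?thesis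
    unfolding infdist_eq_norm_residual[OF assms(1,3)] e_def[symmetric] u_def[symmetric]
    by (simp add: power2_norm_eq_inner inner_diff_left inner_diff_right inner_commute algebra_simps)
qed

lemma continuous_on_residual [continuous_intros]:
  assumes "closed C" "convex C" "C \<noteq> {}" "continuous_on S g"
  shows "continuous_on S (\<lambda>x. residual C (g x))"
  unfolding residual_def
  by (intro continuous_intros assms continuous_on_compose2[OF continuous_on_closest_point]) auto

subsection \<open>Block descent for convex functions\<close>

text \<open>Both bounds have the same linear part, so the error of the linear approximation divided
  by \<open>norm (w - z)\<close> is at most \<open>c * norm (w - z)\<close>. This turns the
  inequalities for distances into differentiability.\<close>

lemma GDERIV_sandwich:
  fixes h :: "'b::real_inner \<Rightarrow> real"
  assumes "\<And>w. h z + g \<bullet> (w - z) \<le> h w"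
    and "\<And>w. h w \<le> h z + g \<bullet> (w - z) + c * (norm (w - z))\<^sup>2"
  shows "GDERIV h z :> g"
  unfolding gderiv_def
proof (rule has_derivativeI_sandwich[where e = 1 and H = "\<lambda>w. c * norm (w - z)"])
  show "bounded_linear (\<lambda>v. v \<bullet> g)"
    by (rule bounded_linear_inner_left)
  fix w assume "w \<noteq> z"
  have "norm (h w - h z - (w - z) \<bullet> g) \<le> c * (norm (w - z))\<^sup>2"
    using assms[of w] by (simp add: inner_commute abs_le_iff)
  then show "norm (h w - h z - (w - z) \<bullet> g) / norm (w - z) \<le> c * norm (w - z)"
    using \<open>w \<noteq> z\<close> by (simp add: divide_le_eq power2_eq_square mult.assoc)
next
  show "((\<lambda>w. c * norm (w - z)) \<longlongrightarrow> 0) (at z)"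
    by (auto intro!: tendsto_eq_intros)
qed simp

text \<open>Needed to evaluate the definite description in \<open>block_gradient\<close>. Two
  vectors representing the same derivative agree when tested against their difference.\<close>

lemma GDERIV_unique:
  assumes "GDERIV h z :> D" "GDERIV h z :> E"
  shows "D = E"
proof -
  have "(\<lambda>v. v \<bullet> D) = (\<lambda>v. v \<bullet> E)"
    using assms unfolding gderiv_def by (rule has_derivative_unique)
  then have "(D - E) \<bullet> D = (D - E) \<bullet> E"
    by (rule fun_cong)
  then have "(D - E) \<bullet> (D - E) = 0"
    by (simp add: inner_diff_right)
  then show ?thesis
    by simp
qed

lemma block_update_same [simp]: "block_update x i (x $ i) = x"
  by (simp add: block_update_def vec_eq_iff)

lemma update_eq_block_update:
  assumes "\<And>j. j \<noteq> i \<Longrightarrow> y $ j = x $ j"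
  shows "y = block_update x i (y $ i)"
  using assms by (simp add: block_update_def vec_eq_iff)

text \<open>These are the properties of the cost on which the convergence argument rests. Smoothness
  is asked along one block at a time, because a step changes one block only;
  \<open>bounded_sublevel\<close> provides compactness.\<close>

locale smooth_convex =
  fixes f :: "'b::euclidean_space ^ 'n::finite \<Rightarrow> real"
    and G :: "'b ^ 'n \<Rightarrow> 'b ^ 'n"
    and L :: real
  assumes subgradient: "f x + G x \<bullet> (y - x) \<le> f y"
    and block_upper:
      "f (block_update x i w) \<le> f x + G x $ i \<bullet> (w - x $ i) + L/2 * (norm (w - x $ i))\<^sup>2"
    and L_pos: "0 < L"
    and cont_f: "continuous_on UNIV f"
    and cont_G: "continuous_on UNIV G"
    and nonneg: "0 \<le> f x"
    and bounded_sublevel: "bounded {x. f x \<le> R}"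
begin

lemma block_lower: "f x + G x $ i \<bullet> (w - x $ i) \<le> f (block_update x i w)"
proof -
  have "G x \<bullet> (block_update x i w - x) = (\<Sum>j\<in>UNIV. if j = i then G x $ i \<bullet> (w - x $ i) else 0)"
    unfolding inner_vec_def by (intro sum.cong) (auto simp: block_update_def)
  then show ?thesis
    using subgradient[of x "block_update x i w"] by simp
qed

lemma block_gradient_eq: "block_gradient f i x = G x $ i"
proof -
  have "GDERIV (\<lambda>w. f (block_update x i w)) (x $ i) :> G x $ i"
    using block_lower[of x i] block_upper[of x i]
    by (intro GDERIV_sandwich[where c = "L/2"]) auto
  then show ?thesis
    unfolding block_gradient_def using GDERIV_unique by blast
qed

text \<open>The step of length \<open>1/L\<close> minimizes the quadratic majorant of
  \<open>block_upper\<close> over \<open>w\<close>, and the right-hand side is that minimum.\<close>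

lemma gradient_step_descent:
  "f (block_update x i (x $ i - (1/L) *\<^sub>R G x $ i)) \<le> f x - (norm (G x $ i))\<^sup>2 / (2 * L)"
  using block_upper[of x i "x $ i - (1/L) *\<^sub>R G x $ i"] L_pos
  by (simp add: power2_norm_eq_inner[symmetric] power_mult_distrib power2_eq_square field_simps)

lemma gradient_update_eq:
  assumes "gradient_update f L i x y"
  shows "y = block_update x i (x $ i - (1/L) *\<^sub>R G x $ i)"
  using assms by (simp add: gradient_update_def block_gradient_eq block_update_def vec_eq_iff)

lemma update_descent:
  assumes "exact_update f i x y \<or> gradient_update f L i x y"
  shows "f y \<le> f x - (norm (G x $ i))\<^sup>2 / (2 * L)"
  using assms
proof
  assume e: "exact_update f i x y"
  then have "y = block_update x i (y $ i)"
    by (intro update_eq_block_update) (auto simp: exact_update_def)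
  \<comment> \<open>Exact minimization over the block does at least as well as the gradient step, so
    it inherits the same decrease.\<close>
  moreover have "f (block_update x i (y $ i)) \<le> f (block_update x i w)" for w
    using e by (auto simp: exact_update_def is_arg_min_def not_less)
  ultimately show ?thesis
    using gradient_step_descent order_trans by metis
next
  assume "gradient_update f L i x y"
  then show ?thesis
    using gradient_update_eq gradient_step_descent by metis
qed

section \<open>Compact sublevel sets, existence of minimizers, and small gradients\<close>

lemma compact_sublevel: "compact {x. f x \<le> R}"
  unfolding compact_eq_bounded_closed
  using bounded_sublevel closed_Collect_le[OF cont_f continuous_on_const] by auto

lemma minimizers_iff: "z \<in> minimizers f \<longleftrightarrow> (\<forall>y. f z \<le> f y)"
proof -
  have bdd: "bdd_below (range f)"
    using nonneg by (intro bdd_belowI[of _ 0]) auto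
  show ?thesis
  proof
    assume "z \<in> minimizers f"
    then have "f z = (INF y. f y)"
      by (simp add: minimizers_def)
    then show "\<forall>y. f z \<le> f y"
      using cINF_lower[OF bdd] by simp
  next
    assume "\<forall>y. f z \<le> f y"
    then have "f z \<le> (INF y. f y)"
      by (intro cINF_greatest) auto
    then show "z \<in> minimizers f"
      using cINF_lower[OF bdd, of z] by (simp add: minimizers_def)
  qed
qed

text \<open>A minimum over the compact sublevel set at level \<open>f 0\<close> is global, since
  points outside have larger values. Nonemptiness matters for the meaning of the result:
  \<open>infdist\<close> to the empty set is 0 by convention.\<close>

lemma minimizers_nonempty: "minimizers f \<noteq> {}"
proof -
  obtain z where z: "f z \<le> f 0" "\<And>y. f y \<le> f 0 \<Longrightarrow> f z \<le> f y"
    using continuous_attains_inf[OF compact_sublevel[of "f 0"], of f] continuous_on_subset[OF cont_f]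
    by (auto simp: subset_UNIV)
  then have "f z \<le> f y" for y
    using order_trans[of "f z" "f 0" "f y"] by (cases "f y \<le> f 0") auto
  then show ?thesis
    using minimizers_iff by blast
qed

text \<open>On the compact set of points of level at most \<open>R\<close> and at distance at least
  \<open>e\<close> from the minimizers, the gradient does not vanish, so its norm has a positive
  lower bound. Gradients below that bound force the iterates out of this set.\<close>

lemma infdist_minimizers_tendsto_0:
  assumes level: "\<And>k. f (u k) \<le> R" and grad: "(\<lambda>k. G (u k)) \<longlonglongrightarrow> 0"
  shows "(\<lambda>k. infdist (u k) (minimizers f)) \<longlonglongrightarrow> 0"
proof (rule tendstoI)
  fix e :: real assume "0 < e"
  define K where "K = {x. f x \<le> R} \<inter> {x. e \<le> infdist x (minimizers f)}"
  have "closed {x. e \<le> infdist x (minimizers f)}"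
    by (intro closed_Collect_le continuous_intros)
  then have "compact K"
    unfolding K_def by (intro compact_Int_closed compact_sublevel)
  have G_nz: "G z \<noteq> 0" if "z \<in> K" for z
  proof
    assume "G z = 0"
    then have "z \<in> minimizers f"
      using subgradient[of z] by (simp add: minimizers_iff)
    then show False
      using that \<open>0 < e\<close> by (simp add: K_def)
  qed
  have "\<exists>c>0. \<forall>z\<in>K. c \<le> norm (G z)"
  proof (cases "K = {}")
    case False
    obtain z where "z \<in> K" "\<forall>y\<in>K. norm (G z) \<le> norm (G y)"
      using continuous_attains_inf[OF \<open>compact K\<close> False, of "\<lambda>z. norm (G z)"]
        continuous_on_subset[OF continuous_on_norm[OF cont_G]] by auto
    then show ?thesis
      using G_nz by (intro exI[of _ "norm (G z)"]) auto
  qed (auto intro: exI[of _ 1])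
  then obtain c where c: "0 < c" "\<And>z. z \<in> K \<Longrightarrow> c \<le> norm (G z)"
    by blast
  have "\<forall>\<^sub>F k in sequentially. dist (G (u k)) 0 < c"
    using grad \<open>0 < c\<close> by (rule tendstoD)
  then show "\<forall>\<^sub>F k in sequentially. dist (infdist (u k) (minimizers f)) 0 < e"
  proof eventually_elim
    case (elim k)
    then have "u k \<notin> K"
      using c(2)[of "u k"] by auto
    then show ?case
      using level[of k] by (auto simp: K_def infdist_nonneg)
  qed
qed

section \<open>Descent along a single trajectory\<close>

lemma level_decreasing:
  assumes upd: "\<And>k. exact_update f (s k) (u k) (u (Suc k)) \<or> gradient_update f L (s k) (u k) (u (Suc k))"
  shows "f (u (Suc k)) \<le> f (u k)"
proof -
  have "0 \<le> (norm (G (u k) $ s k))\<^sup>2 / (2 * L)"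
    using L_pos by simp
  then show ?thesis
    using update_descent[OF upd[of k]] by linarith
qed

text \<open>The decreases of the cost telescope. The indicator discards the steps made above level
  \<open>R\<close>, so the bound does not depend on \<open>f (u 0)\<close>, which for a random start
  may be unbounded.\<close>

lemma sum_active_gradients_le:
  assumes upd: "\<And>k. exact_update f (s k) (u k) (u (Suc k)) \<or> gradient_update f L (s k) (u k) (u (Suc k))"
    and "0 \<le> R"
  shows "(\<Sum>k<N. (norm (G (u k) $ s k))\<^sup>2 * indicator {y. f y \<le> R} (u k)) \<le> 2 * L * R"
proof -
  have desc: "(norm (G (u k) $ s k))\<^sup>2 \<le> 2 * L * (f (u k) - f (u (Suc k)))" for k
    using update_descent[OF upd[of k]] L_pos by (simp add: field_simps)
  note dec = level_decreasing[where s = s and u = u, OF upd]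
  \<comment> \<open>The truncated level \<open>min R (f (u N))\<close> serves as potential: it
    cannot increase, it starts at most at \<open>R\<close>, and it drops by the full decrease of
    \<open>f\<close> whenever the indicator is 1.\<close>
  have "(\<Sum>k<N. (norm (G (u k) $ s k))\<^sup>2 * indicator {y. f y \<le> R} (u k))
      \<le> 2 * L * (R - min R (f (u N)))"
  proof (induction N)
    case 0
    then show ?case by (simp add: L_pos less_imp_le)
  next
    case (Suc N)
    have "(norm (G (u N) $ s N))\<^sup>2 * indicator {y. f y \<le> R} (u N)
        \<le> 2 * L * (min R (f (u N)) - min R (f (u (Suc N))))"
      using desc[of N] dec[of N] L_pos by (auto simp: indicator_def min_def)
    with Suc show ?case
      by (simp add: algebra_simps)
  qed
  also have "\<dots> \<le> 2 * L * R"
    using nonneg[of "u N"] L_pos \<open>0 \<le> R\<close> by (simp add: min_def)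
  finally show ?thesis .
qed

end

subsection \<open>Activation of a block independently of the past\<close>

lemma indep_rvs_prob:
  assumes "prob_space M" "indep_rvs M S X T Y" "B \<in> sets S" "C \<in> sets T"
  shows "measure M ({\<omega> \<in> space M. X \<omega> \<in> B} \<inter> {\<omega> \<in> space M. Y \<omega> \<in> C})
    = measure M {\<omega> \<in> space M. X \<omega> \<in> B} * measure M {\<omega> \<in> space M. Y \<omega> \<in> C}"
proof -
  interpret prob_space M by fact
  have "measure M ((X -` B \<inter> space M) \<inter> (Y -` C \<inter> space M))
    = measure M (X -` B \<inter> space M) * measure M (Y -` C \<inter> space M)"
    using assms(2-) unfolding indep_rvs_def
    by (intro indep_setD[of "sets (vimage_algebra (space M) X S)" "sets (vimage_algebra (space M) Y T)"])
      (auto intro: in_vimage_algebra)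
  moreover have "X -` B \<inter> space M = {\<omega> \<in> space M. X \<omega> \<in> B}" "Y -` C \<inter> space M = {\<omega> \<in> space M. Y \<omega> \<in> C}"
    by auto
  ultimately show ?thesis by simp
qed

text \<open>Both events are cylinders: the first depends on coordinate \<open>k\<close> of the
  recorded iterates, the second on coordinate \<open>Suc k\<close> of the future
  activations.\<close>

lemma nonanticipative_indep_next:
  fixes x :: "nat \<Rightarrow> 'w \<Rightarrow> 'x::topological_space" and \<xi> :: "nat \<Rightarrow> 'w \<Rightarrow> 'n"
  assumes "prob_space M" and na: "nonanticipative M \<xi> x"
  shows "x k \<in> borel_measurable M"
    and "T \<in> sets borel \<Longrightarrow>
      measure M ({\<omega> \<in> space M. x k \<omega> \<in> T} \<inter> {\<omega> \<in> space M. \<xi> (Suc k) \<omega> = i})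
      = measure M {\<omega> \<in> space M. x k \<omega> \<in> T} * measure M {\<omega> \<in> space M. \<xi> (Suc k) \<omega> = i}"
proof -
  let ?S = "(\<Pi>\<^sub>M j\<in>{..k}. borel :: 'x measure) \<Otimes>\<^sub>M (\<Pi>\<^sub>M j\<in>{1..k}. count_space (UNIV :: 'n set))"
  let ?X = "\<lambda>\<omega>. (\<lambda>j\<in>{..k}. x j \<omega>, \<lambda>j\<in>{1..k}. \<xi> j \<omega>)"
  let ?U = "\<Pi>\<^sub>M j\<in>{k<..}. count_space (UNIV :: 'n set)"
  let ?Y = "\<lambda>\<omega>. \<lambda>j\<in>{k<..}. \<xi> j \<omega>"
  have ind: "indep_rvs M ?S ?X ?U ?Y"
    using na unfolding nonanticipative_def by blast
  then have X: "?X \<in> measurable M ?S" and Y: "?Y \<in> measurable M ?U"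
    by (auto simp: indep_rvs_def)
  have fst_k: "(\<lambda>p. fst p k) \<in> measurable ?S borel"
    by (rule measurable_compose[OF measurable_fst measurable_component_singleton]) simp
  have "(\<lambda>\<omega>. fst (?X \<omega>) k) \<in> borel_measurable M"
    using measurable_compose[OF X fst_k] .
  then show "x k \<in> borel_measurable M"
    by simp
  assume T: "T \<in> sets borel"
  define B where "B = (\<lambda>p. fst p k) -` T \<inter> space ?S"
  define C where "C = (\<lambda>q. q (Suc k)) -` {i} \<inter> space ?U"
  have "B \<in> sets ?S"
    unfolding B_def by (rule measurable_sets[OF fst_k T])
  moreover have "C \<in> sets ?U"
    unfolding C_def by (rule measurable_sets[OF measurable_component_singleton]) auto
  ultimately have "measure M ({\<omega> \<in> space M. ?X \<omega> \<in> B} \<inter> {\<omega> \<in> space M. ?Y \<omega> \<in> C})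
    = measure M {\<omega> \<in> space M. ?X \<omega> \<in> B} * measure M {\<omega> \<in> space M. ?Y \<omega> \<in> C}"
    by (rule indep_rvs_prob[OF assms(1) ind])
  moreover have "{\<omega> \<in> space M. ?X \<omega> \<in> B} = {\<omega> \<in> space M. x k \<omega> \<in> T}"
    using measurable_space[OF X] by (auto simp: B_def)
  moreover have "{\<omega> \<in> space M. ?Y \<omega> \<in> C} = {\<omega> \<in> space M. \<xi> (Suc k) \<omega> = i}"
    using measurable_space[OF Y] by (auto simp: C_def)
  ultimately show "measure M ({\<omega> \<in> space M. x k \<omega> \<in> T} \<inter> {\<omega> \<in> space M. \<xi> (Suc k) \<omega> = i})
      = measure M {\<omega> \<in> space M. x k \<omega> \<in> T} * measure M {\<omega> \<in> space M. \<xi> (Suc k) \<omega> = i}"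
    by simp
qed

context prob_space
begin

text \<open>For iterates given by a recursion, independence of the future is derived from the start
  instead of being assumed. The claim covers every finite window of future activations, not just the
  next one, because the induction step consumes the first activation of the window.\<close>

lemma iterated_indep_future:
  fixes x :: "nat \<Rightarrow> 'a \<Rightarrow> 'x::topological_space" and \<xi> :: "nat \<Rightarrow> 'a \<Rightarrow> 'n::finite"
  assumes \<xi>_indep: "indep_vars (\<lambda>_. count_space UNIV) \<xi> {1..}"
    and x0: "indep_rvs M borel (x 0) (\<Pi>\<^sub>M k\<in>{1..}. count_space UNIV) (\<lambda>\<omega>. \<lambda>k\<in>{1..}. \<xi> k \<omega>)"
    and F: "\<And>i. F i \<in> borel_measurable borel"
    and rec: "\<forall>\<omega>\<in>space M. \<forall>k. x (Suc k) \<omega> = F (\<xi> (Suc k) \<omega>) (x k \<omega>)"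
  shows "x k \<in> borel_measurable M \<and> (\<forall>T\<in>sets borel. \<forall>s N.
    prob ({\<omega> \<in> space M. x k \<omega> \<in> T} \<inter> {\<omega> \<in> space M. \<forall>j\<in>{k<..N}. \<xi> j \<omega> = s j})
    = prob {\<omega> \<in> space M. x k \<omega> \<in> T} * (\<Prod>j\<in>{k<..N}. prob {\<omega> \<in> space M. \<xi> j \<omega> = s j}))"
proof (induction k)
  case 0
  let ?Y = "\<lambda>\<omega>. \<lambda>k\<in>{1..}. \<xi> k \<omega>"
  let ?U = "\<Pi>\<^sub>M k\<in>{1..}. count_space UNIV"
  have Y: "?Y \<in> measurable M ?U" and X: "x 0 \<in> borel_measurable M"
    using x0 by (auto simp: indep_rvs_def)
  have "prob ({\<omega> \<in> space M. x 0 \<omega> \<in> T} \<inter> {\<omega> \<in> space M. \<forall>j\<in>{0<..N}. \<xi> j \<omega> = s j})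
    = prob {\<omega> \<in> space M. x 0 \<omega> \<in> T} * (\<Prod>j\<in>{0<..N}. prob {\<omega> \<in> space M. \<xi> j \<omega> = s j})"
    if T: "T \<in> sets borel" for T s N
  proof -
    define C where "C = {q \<in> space ?U. \<forall>j\<in>{0<..N}. q j = s j}"
    have "(\<lambda>q. q j) -` {s j} \<inter> space ?U \<in> sets ?U" if "j \<in> {0<..N}" for j
      using that by (intro measurable_sets[OF measurable_component_singleton]) auto
    then have "{q \<in> space ?U. q j = s j} \<in> sets ?U" if "j \<in> {0<..N}" for j
      using that by (simp add: vimage_def Int_def conj_commute)
    then have "C \<in> sets ?U"
      unfolding C_def by (intro sets.sets_Collect_finite_All) auto
    then have "prob ({\<omega> \<in> space M. x 0 \<omega> \<in> T} \<inter> {\<omega> \<in> space M. ?Y \<omega> \<in> C})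
      = prob {\<omega> \<in> space M. x 0 \<omega> \<in> T} * prob {\<omega> \<in> space M. ?Y \<omega> \<in> C}"
      by (rule indep_rvs_prob[OF prob_space_axioms x0 T])
    moreover have "{\<omega> \<in> space M. ?Y \<omega> \<in> C} = {\<omega> \<in> space M. \<forall>j\<in>{0<..N}. \<xi> j \<omega> = s j}"
      using measurable_space[OF Y] by (auto simp: C_def)
    moreover have "prob {\<omega> \<in> space M. \<forall>j\<in>{0<..N}. \<xi> j \<omega> = s j}
      = (\<Prod>j\<in>{0<..N}. prob {\<omega> \<in> space M. \<xi> j \<omega> = s j})"
    \<comment> \<open>An intersection over an empty index set would be the whole type rather than
      \<open>space M\<close>, so the empty window is treated separately.\<close>
    proof (cases "N = 0")
      case False
      have "prob (\<Inter>j\<in>{0<..N}. \<xi> j -` {s j} \<inter> space M) = (\<Prod>j\<in>{0<..N}. prob (\<xi> j -` {s j} \<inter> space M))"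
        using \<xi>_indep False unfolding indep_vars_def2
        by (intro indep_setsD[where F = "\<lambda>i. {\<xi> i -` A \<inter> space M |A. A \<in> sets (count_space UNIV)}"
              and I = "{1..}"]) auto
      moreover have "(\<Inter>j\<in>{0<..N}. \<xi> j -` {s j} \<inter> space M) = {\<omega> \<in> space M. \<forall>j\<in>{0<..N}. \<xi> j \<omega> = s j}"
        using False by auto
      moreover have "\<xi> j -` {s j} \<inter> space M = {\<omega> \<in> space M. \<xi> j \<omega> = s j}" for j
        by auto
      ultimately show ?thesis
        by simp
    qed (simp add: prob_space)
    ultimately show ?thesis
      by simp
  qed
  with X show ?case
    by blast
next
  case (Suc k)
  then have X: "x k \<in> borel_measurable M"
    and IH: "\<And>T s N. T \<in> sets borel \<Longrightarrow>
      prob ({\<omega> \<in> space M. x k \<omega> \<in> T} \<inter> {\<omega> \<in> space M. \<forall>j\<in>{k<..N}. \<xi> j \<omega> = s j})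
      = prob {\<omega> \<in> space M. x k \<omega> \<in> T} * (\<Prod>j\<in>{k<..N}. prob {\<omega> \<in> space M. \<xi> j \<omega> = s j})"
    by blast+
  have \<xi>_meas: "\<xi> j \<in> measurable M (count_space UNIV)" if "1 \<le> j" for j
    using \<xi>_indep that by (auto simp: indep_vars_def2)
  \<comment> \<open>The activation has finitely many values, so measurability can be checked with
    its value fixed.\<close>
  have "(\<lambda>\<omega>. F (\<xi> (Suc k) \<omega>) (x k \<omega>)) \<in> borel_measurable M"
    by (rule measurable_compose_countable[of "\<lambda>i \<omega>. F i (x k \<omega>)"])
      (use measurable_compose[OF X F] \<xi>_meas[of "Suc k"] in simp_all)
  then have X': "x (Suc k) \<in> borel_measurable M"
    by (simp add: rec cong: measurable_cong)
  define c where "c T = (\<Sum>i\<in>UNIV. prob {\<omega> \<in> space M. x k \<omega> \<in> F i -` T} * prob {\<omega> \<in> space M. \<xi> (Suc k) \<omega> = i})" for T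
  have split: "prob ({\<omega> \<in> space M. x (Suc k) \<omega> \<in> T} \<inter> {\<omega> \<in> space M. \<forall>j\<in>{Suc k<..N}. \<xi> j \<omega> = s j})
    = c T * (\<Prod>j\<in>{Suc k<..N}. prob {\<omega> \<in> space M. \<xi> j \<omega> = s j})"
    if T: "T \<in> sets borel" and N: "Suc k \<le> N" for T s N
  proof -
    \<comment> \<open>The event is split by the value \<open>i\<close> of the activation
      \<open>\<xi> (Suc k)\<close>. Writing \<open>i\<close> into the pattern at
      \<open>Suc k\<close> makes each piece an instance of the induction hypothesis with the longer
      window.\<close>
    define E where "E i = {\<omega> \<in> space M. x k \<omega> \<in> F i -` T}
      \<inter> {\<omega> \<in> space M. \<forall>j\<in>{k<..N}. \<xi> j \<omega> = (s(Suc k := i)) j}" for i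
    have ins: "{k<..N} = insert (Suc k) {Suc k<..N}"
      using N by auto
    have FT: "F i -` T \<in> sets borel" for i
      using measurable_sets[OF F T] by simp
    have "{\<omega> \<in> space M. x (Suc k) \<omega> \<in> T} \<inter> {\<omega> \<in> space M. \<forall>j\<in>{Suc k<..N}. \<xi> j \<omega> = s j} = (\<Union>i\<in>UNIV. E i)"
      unfolding E_def ins by (auto simp: rec)
    moreover have "E i \<in> events" for i
    proof -
      have "{\<omega> \<in> space M. x k \<omega> \<in> F i -` T} \<in> events"
        using measurable_sets[OF X FT[of i]] by (simp add: vimage_def Int_def conj_commute)
      moreover have "{\<omega> \<in> space M. \<xi> j \<omega> = i'} \<in> events" if "j \<in> {k<..N}" for j i'
        using measurable_sets[OF \<xi>_meas[of j], of "{i'}"] that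
        by (simp add: vimage_def Int_def conj_commute)
      ultimately show ?thesis
        unfolding E_def by (intro sets.Int sets.sets_Collect_finite_All) auto
    qed
    moreover have "disjoint_family_on E UNIV"
      unfolding disjoint_family_on_def E_def ins by auto
    ultimately have "prob ({\<omega> \<in> space M. x (Suc k) \<omega> \<in> T} \<inter> {\<omega> \<in> space M. \<forall>j\<in>{Suc k<..N}. \<xi> j \<omega> = s j})
      = (\<Sum>i\<in>UNIV. prob (E i))"
      by (simp add: finite_measure_finite_Union image_subset_iff)
    also have "\<dots> = c T * (\<Prod>j\<in>{Suc k<..N}. prob {\<omega> \<in> space M. \<xi> j \<omega> = s j})"
      unfolding c_def sum_distrib_right
    proof (rule sum.cong)
      fix i
      have "(\<Prod>j\<in>{k<..N}. prob {\<omega> \<in> space M. \<xi> j \<omega> = (s(Suc k := i)) j})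
        = prob {\<omega> \<in> space M. \<xi> (Suc k) \<omega> = i} * (\<Prod>j\<in>{Suc k<..N}. prob {\<omega> \<in> space M. \<xi> j \<omega> = s j})"
        unfolding ins by (subst prod.insert) (auto intro!: prod.cong)
      then show "prob (E i) = prob {\<omega> \<in> space M. x k \<omega> \<in> F i -` T} * prob {\<omega> \<in> space M. \<xi> (Suc k) \<omega> = i}
          * (\<Prod>j\<in>{Suc k<..N}. prob {\<omega> \<in> space M. \<xi> j \<omega> = s j})"
        unfolding E_def IH[OF FT] by simp
    qed simp
    finally show ?thesis .
  qed
  \<comment> \<open>For \<open>N = Suc k\<close> the window is empty and the product is 1, which
    identifies \<open>c T\<close>; this factor depends on neither \<open>s\<close> nor
    \<open>N\<close>.\<close>
  have c_eq: "c T = prob {\<omega> \<in> space M. x (Suc k) \<omega> \<in> T}" if "T \<in> sets borel" for T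
    using split[OF that, of "Suc k"] by (simp add: Int_absorb2 subset_eq)
  have "prob ({\<omega> \<in> space M. x (Suc k) \<omega> \<in> T} \<inter> {\<omega> \<in> space M. \<forall>j\<in>{Suc k<..N}. \<xi> j \<omega> = s j})
    = prob {\<omega> \<in> space M. x (Suc k) \<omega> \<in> T} * (\<Prod>j\<in>{Suc k<..N}. prob {\<omega> \<in> space M. \<xi> j \<omega> = s j})"
    if "T \<in> sets borel" for T s N
  proof (cases "Suc k \<le> N")
    case True
    then show ?thesis
      using split[OF that] c_eq[OF that] by simp
  next
    case False
    then show ?thesis
      by (simp add: Int_absorb2 subset_eq)
  qed
  with X' show ?case
    by blast
qed

text \<open>
  The expected sum along the activated blocks is a sum over all blocks weighted by the activation
  probabilities, so a bound on the former makes the latter finite almost surely.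
\<close>

lemma AE_summable_all_blocks:
  fixes x :: "nat \<Rightarrow> 'a \<Rightarrow> 'x::topological_space" and \<xi> :: "nat \<Rightarrow> 'a \<Rightarrow> 'n"
    and \<psi> :: "'n \<Rightarrow> 'x \<Rightarrow> real"
  assumes x: "\<And>k. x k \<in> borel_measurable M"
    and \<xi>: "\<And>k. \<xi> (Suc k) \<in> measurable M (count_space UNIV)"
    and indep: "\<And>k T. T \<in> sets borel \<Longrightarrow>
      prob ({\<omega> \<in> space M. x k \<omega> \<in> T} \<inter> {\<omega> \<in> space M. \<xi> (Suc k) \<omega> = i})
      = prob {\<omega> \<in> space M. x k \<omega> \<in> T} * p"
    and p: "0 < p"
    and \<psi>: "\<And>j. \<psi> j \<in> borel_measurable borel" "\<And>j y. 0 \<le> \<psi> j y"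
    and bound: "\<And>\<omega> N. \<omega> \<in> space M \<Longrightarrow> (\<Sum>k<N. \<psi> (\<xi> (Suc k) \<omega>) (x k \<omega>)) \<le> C"
  shows "AE \<omega> in M. summable (\<lambda>k. \<psi> i (x k \<omega>))"
proof -
  note [measurable] = x \<psi>(1)
  define E where "E k = {\<omega> \<in> space M. \<xi> (Suc k) \<omega> = i}" for k
  have E [measurable]: "E k \<in> events" for k
    using measurable_sets[OF \<xi>[of k], of "{i}"] by (simp add: E_def vimage_def Int_def conj_commute)
  \<comment> \<open>Independence in a form suited to integration: restricting \<open>M\<close> to
    \<open>E k\<close> scales the law of \<open>x k\<close> by \<open>p\<close>, so any nonnegative
    measurable function of \<open>x k\<close> has its integral scaled by \<open>p\<close>.\<close>
  have law: "distr (density M (indicator (E k))) borel (x k) = scale_measure (ennreal p) (distr M borel (x k))" for k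
  proof (rule measure_eqI)
    fix T assume "T \<in> sets (distr (density M (indicator (E k))) borel (x k))"
    then have T [measurable]: "T \<in> sets borel" by simp
    have eq: "x k -` T \<inter> space M = {\<omega> \<in> space M. x k \<omega> \<in> T}"
      by auto
    have X: "{\<omega> \<in> space M. x k \<omega> \<in> T} \<in> events"
      by measurable
    have "emeasure (distr (density M (indicator (E k))) borel (x k)) T
      = emeasure (density M (indicator (E k))) {\<omega> \<in> space M. x k \<omega> \<in> T}"
      by (subst emeasure_distr) (auto simp: eq)
    also have "\<dots> = emeasure M (E k \<inter> {\<omega> \<in> space M. x k \<omega> \<in> T})"
      by (subst emeasure_density) (use X in \<open>auto simp flip: indicator_inter_arith intro!: nn_integral_indicator\<close>)
    also have "\<dots> = ennreal (prob {\<omega> \<in> space M. x k \<omega> \<in> T} * p)"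
      using indep[OF T, of k] by (simp add: emeasure_eq_measure E_def Int_commute)
    also have "\<dots> = ennreal p * emeasure M {\<omega> \<in> space M. x k \<omega> \<in> T}"
      using p by (simp add: emeasure_eq_measure ennreal_mult' mult.commute)
    finally show "emeasure (distr (density M (indicator (E k))) borel (x k)) T
      = emeasure (scale_measure (ennreal p) (distr M borel (x k))) T"
      by (simp add: emeasure_distr eq)
  qed simp
  have step: "ennreal p * (\<integral>\<^sup>+\<omega>. ennreal (\<psi> i (x k \<omega>)) \<partial>M)
    = (\<integral>\<^sup>+\<omega>. indicator (E k) \<omega> * ennreal (\<psi> i (x k \<omega>)) \<partial>M)" for k
  proof -
    have "(\<integral>\<^sup>+\<omega>. indicator (E k) \<omega> * ennreal (\<psi> i (x k \<omega>)) \<partial>M)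
      = (\<integral>\<^sup>+y. ennreal (\<psi> i y) \<partial>distr (density M (indicator (E k))) borel (x k))"
      by (subst nn_integral_distr) (auto simp: nn_integral_density)
    also have "\<dots> = ennreal p * (\<integral>\<^sup>+\<omega>. ennreal (\<psi> i (x k \<omega>)) \<partial>M)"
      unfolding law by (subst nn_integral_scale_measure) (auto simp: nn_integral_distr)
    finally show ?thesis ..
  qed
  have "ennreal p * (\<integral>\<^sup>+\<omega>. (\<Sum>k. ennreal (\<psi> i (x k \<omega>))) \<partial>M)
    = (\<Sum>k. ennreal p * (\<integral>\<^sup>+\<omega>. ennreal (\<psi> i (x k \<omega>)) \<partial>M))"
    by (simp add: nn_integral_suminf)
  also have "\<dots> = (\<integral>\<^sup>+\<omega>. (\<Sum>k. indicator (E k) \<omega> * ennreal (\<psi> i (x k \<omega>))) \<partial>M)"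
    unfolding step by (simp add: nn_integral_suminf)
  also have "\<dots> \<le> (\<integral>\<^sup>+\<omega>. ennreal C \<partial>M)"
  proof (rule nn_integral_mono)
    fix \<omega> assume \<omega>: "\<omega> \<in> space M"
    show "(\<Sum>k. indicator (E k) \<omega> * ennreal (\<psi> i (x k \<omega>))) \<le> ennreal C"
    proof (rule suminf_le_const[OF summableI])
      fix N
      \<comment> \<open>On \<open>E k\<close> the activated block is \<open>i\<close> and the
        summands agree; off \<open>E k\<close> the left one is 0 and the right one is
        nonnegative.\<close>
      have "(\<Sum>k<N. indicator (E k) \<omega> * ennreal (\<psi> i (x k \<omega>)))
        \<le> (\<Sum>k<N. ennreal (\<psi> (\<xi> (Suc k) \<omega>) (x k \<omega>)))"
        by (intro sum_mono) (auto simp: E_def indicator_def)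
      also have "\<dots> \<le> ennreal C"
        using bound[OF \<omega>] \<psi>(2) by (simp add: ennreal_leI)
      finally show "(\<Sum>k<N. indicator (E k) \<omega> * ennreal (\<psi> i (x k \<omega>))) \<le> ennreal C" .
    qed
  qed
  also have "\<dots> = ennreal C"
    by (simp add: emeasure_space_1)
  \<comment> \<open>An infinite integral multiplied by the positive \<open>p\<close> would stay
    infinite, contradicting the bound \<open>C\<close>.\<close>
  finally have "(\<integral>\<^sup>+\<omega>. (\<Sum>k. ennreal (\<psi> i (x k \<omega>))) \<partial>M) \<noteq> \<infinity>"
    using p by (auto simp: ennreal_mult_top top_unique)
  then have "AE \<omega> in M. (\<Sum>k. ennreal (\<psi> i (x k \<omega>))) \<noteq> \<infinity>"
    by (intro nn_integral_PInf_AE) auto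
  then show ?thesis
    by eventually_elim (auto intro: summable_suminf_not_top simp: \<psi>(2))
qed

end

section \<open>Almost sure convergence for smooth convex costs\<close>

lemma (in smooth_convex) AE_infdist_minimizers_tendsto_0:
  fixes x :: "nat \<Rightarrow> 'w \<Rightarrow> 'b ^ 'n" and \<xi> :: "nat \<Rightarrow> 'w \<Rightarrow> 'n"
  assumes "prob_space M"
    and x: "\<And>k. x k \<in> borel_measurable M"
    and \<xi>: "\<And>k. \<xi> (Suc k) \<in> measurable M (count_space UNIV)"
    and indep: "\<And>i k T. T \<in> sets borel \<Longrightarrow>
      measure M ({\<omega> \<in> space M. x k \<omega> \<in> T} \<inter> {\<omega> \<in> space M. \<xi> (Suc k) \<omega> = i})
      = measure M {\<omega> \<in> space M. x k \<omega> \<in> T} * P i"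
    and P: "\<And>i. 0 < P i"
    and upd: "\<And>\<omega> k. \<omega> \<in> space M \<Longrightarrow> exact_update f (\<xi> (Suc k) \<omega>) (x k \<omega>) (x (Suc k) \<omega>)
      \<or> gradient_update f L (\<xi> (Suc k) \<omega>) (x k \<omega>) (x (Suc k) \<omega>)"
  shows "AE \<omega> in M. (\<lambda>k. infdist (x k \<omega>) (minimizers f)) \<longlonglongrightarrow> 0"
proof -
  interpret prob_space M by fact
  \<comment> \<open>\<open>f (x 0)\<close> need not be integrable; as the levels decrease, truncating at level \<open>R\<close> is harmless
    once \<open>f (x 0 \<omega>) \<le> R\<close>.\<close>
  define \<psi> :: "nat \<Rightarrow> 'n \<Rightarrow> 'b ^ 'n \<Rightarrow> real"
    where "\<psi> R i y = (norm (G y $ i))\<^sup>2 * indicator {y. f y \<le> real R} y" for R i y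
  have "continuous_on UNIV (\<lambda>y. (norm (G y $ i))\<^sup>2)" for i
    by (intro continuous_intros cont_G)
  moreover have "{y. f y \<le> real R} \<in> sets borel" for R
    using closed_Collect_le[OF cont_f continuous_on_const] by (rule borel_closed)
  ultimately have \<psi>_meas: "\<psi> R i \<in> borel_measurable borel" for R i
    unfolding \<psi>_def
    by (intro borel_measurable_times borel_measurable_continuous_onI borel_measurable_indicator)
  have "(\<Sum>k<N. \<psi> R (\<xi> (Suc k) \<omega>) (x k \<omega>)) \<le> 2 * L * real R" if "\<omega> \<in> space M" for \<omega> N R
    unfolding \<psi>_def
    using sum_active_gradients_le[where s = "\<lambda>k. \<xi> (Suc k) \<omega>" and u = "\<lambda>k. x k \<omega>", OF upd[OF that]]
    by simp
  then have "AE \<omega> in M. summable (\<lambda>k. \<psi> R i (x k \<omega>))" for R i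
    by (intro AE_summable_all_blocks[where x = x and \<xi> = \<xi> and \<psi> = "\<psi> R" and p = "P i"
          and C = "2 * L * real R", OF x \<xi> indep P \<psi>_meas]) (auto simp: \<psi>_def)
  \<comment> \<open>The truncation level will be chosen depending on \<open>\<omega>\<close>;
    restricting it to natural numbers lets one null set serve all levels and blocks.\<close>
  then have "AE \<omega> in M. \<forall>R i. summable (\<lambda>k. \<psi> R i (x k \<omega>))"
    by (simp add: AE_all_countable)
  with AE_space show ?thesis
  proof eventually_elim
    case (elim \<omega>)
    obtain R where "f (x 0 \<omega>) \<le> real R"
      using real_arch_simple by blast
    moreover have "decseq (\<lambda>k. f (x k \<omega>))"
      using level_decreasing[where s = "\<lambda>k. \<xi> (Suc k) \<omega>" and u = "\<lambda>k. x k \<omega>", OF upd[OF elim(1)]]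
      by (rule decseq_SucI)
    ultimately have level: "f (x k \<omega>) \<le> real R" for k
      using decseqD[of "\<lambda>k. f (x k \<omega>)" 0 k] by simp
    have "(\<lambda>k. G (x k \<omega>)) \<longlonglongrightarrow> 0"
    proof (rule vec_tendstoI)
      fix i
      have "(\<lambda>k. (norm (G (x k \<omega>) $ i))\<^sup>2) \<longlonglongrightarrow> 0"
        using summable_LIMSEQ_zero[OF elim(2)[THEN spec, THEN spec, of R i]]
        by (simp add: \<psi>_def level)
      from tendsto_real_sqrt[OF this] have "(\<lambda>k. norm (G (x k \<omega>) $ i)) \<longlonglongrightarrow> 0"
        by simp
      then show "(\<lambda>k. G (x k \<omega>) $ i) \<longlonglongrightarrow> 0 $ i"
        by (simp add: tendsto_norm_zero_iff)
    qed
    then show ?case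
      by (rule infdist_minimizers_tendsto_0[OF level])
  qed
qed

subsection \<open>The network cost\<close>

text \<open>Each edge is listed once, with \<open>i < j\<close>, and acts on its two ends with
  opposite signs; the difference of the \<open>of_bool\<close> terms is the incidence coefficient of
  the edge at node \<open>l\<close>.\<close>

definition network_gradient ::
  "('n::{finite,linorder} \<Rightarrow> 'n \<Rightarrow> bool) \<Rightarrow> ('n \<Rightarrow> 'n \<Rightarrow> real) \<Rightarrow>
   ('n \<Rightarrow> 'm::finite set) \<Rightarrow> ('m \<Rightarrow> real ^ 'p) \<Rightarrow> ('n \<Rightarrow> 'm \<Rightarrow> real) \<Rightarrow>
   (real ^ 'p::finite) ^ 'n::{finite,linorder} \<Rightarrow> (real ^ 'p) ^ 'n::{finite,linorder}" where
  "network_gradient adj d A a r x = (\<chi> l.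
     (\<Sum>(i, j) \<in> {(i, j). i < j \<and> adj i j}.
        (of_bool (i = l) - of_bool (j = l)) *\<^sub>R residual (cball 0 (d i j)) (x $ i - x $ j))
   + (\<Sum>k\<in>A l. residual (cball (a k) (r l k)) (x $ l)))"

text \<open>Passing from a sum over nodes to a sum over edges pairs each residual with the
  displacement of its own argument, so that the distance inequalities can be added term by
  term.\<close>

lemma inner_network_gradient:
  "network_gradient adj d A a r x \<bullet> v =
     (\<Sum>(i, j) \<in> {(i, j). i < j \<and> adj i j}. residual (cball 0 (d i j)) (x $ i - x $ j) \<bullet> (v $ i - v $ j))
   + (\<Sum>i\<in>UNIV. \<Sum>k\<in>A i. residual (cball (a k) (r i k)) (x $ i) \<bullet> v $ i)"
proof -
  define E where "E = {(i, j). i < j \<and> adj i j}"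
  define \<rho> where "\<rho> i j = residual (cball 0 (d i j)) (x $ i - x $ j)" for i j
  have "(\<Sum>l\<in>UNIV. (\<Sum>(i, j)\<in>E. (of_bool (i = l) - of_bool (j = l)) *\<^sub>R \<rho> i j) \<bullet> v $ l)
    = (\<Sum>l\<in>UNIV. \<Sum>e\<in>E. (of_bool (fst e = l) - of_bool (snd e = l)) * (\<rho> (fst e) (snd e) \<bullet> v $ l))"
    by (simp add: inner_sum_left case_prod_beta)
  \<comment> \<open>After the exchange, only the two ends of an edge contribute to the inner
    sum.\<close>
  also have "\<dots> = (\<Sum>e\<in>E. \<Sum>l\<in>UNIV. (of_bool (fst e = l) - of_bool (snd e = l)) * (\<rho> (fst e) (snd e) \<bullet> v $ l))"
    by (rule sum.swap)
  also have "\<dots> = (\<Sum>e\<in>E. \<rho> (fst e) (snd e) \<bullet> (v $ fst e - v $ snd e))"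
  proof (rule sum.cong)
    have "(\<Sum>l\<in>UNIV. of_bool (i = l) * c l) = c i" for i and c :: "'l::finite \<Rightarrow> real"
      by (simp add: of_bool_def if_distrib[of "\<lambda>b. b * _"] cong: if_cong)
    then show "(\<Sum>l\<in>UNIV. (of_bool (fst e = l) - of_bool (snd e = l)) * (\<rho> (fst e) (snd e) \<bullet> v $ l))
      = \<rho> (fst e) (snd e) \<bullet> (v $ fst e - v $ snd e)" for e
      by (simp add: left_diff_distrib sum_subtractf inner_diff_right)
  qed simp
  finally show ?thesis
    unfolding network_gradient_def inner_vec_def[of "vec_lambda _"] E_def[symmetric] \<rho>_def
    by (simp add: inner_add_left sum.distrib inner_sum_left case_prod_beta)
qed

lemma norm_le_infdist_cball:
  fixes c :: "'a::euclidean_space"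
  assumes "0 \<le> \<rho>"
  shows "norm z \<le> infdist z (cball c \<rho>) + norm c + \<rho>"
proof -
  obtain q where "q \<in> cball c \<rho>" "infdist z (cball c \<rho>) = dist z q"
    using infdist_attains_inf[of "cball c \<rho>" z] assms by auto
  moreover have "norm z \<le> dist z q + dist c q + norm c"
    using norm_triangle_ineq[of "z - q" "q - c"] norm_triangle_ineq[of "z - c" c]
    by (simp add: dist_norm norm_minus_commute)
  ultimately show ?thesis
    by simp
qed

locale sensor_network =
  fixes adj :: "'n::{finite,linorder} \<Rightarrow> 'n \<Rightarrow> bool"
    and d :: "'n \<Rightarrow> 'n \<Rightarrow> real"
    and A :: "'n \<Rightarrow> 'm::finite set"
    and a :: "'m \<Rightarrow> real ^ 'p::finite"
    and r :: "'n \<Rightarrow> 'm \<Rightarrow> real"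
  assumes adj_sym: "\<And>i j. adj i j \<Longrightarrow> adj j i"
    and adj_irrefl: "\<And>i. \<not> adj i i"
    and connected: "\<And>i j. adj\<^sup>*\<^sup>* i j"
    and anchored: "\<exists>i. A i \<noteq> {}"
    and d_nonneg: "\<And>i j. adj i j \<Longrightarrow> 0 \<le> d i j"
    and r_nonneg: "\<And>i k. k \<in> A i \<Longrightarrow> 0 \<le> r i k"
begin

abbreviation "cost \<equiv> network_cost adj d A a r"
abbreviation "grad \<equiv> network_gradient adj d A a r"
abbreviation "edges \<equiv> {(i, j). i < j \<and> adj i j}"

text \<open>Each term of the cost is half a squared distance at a linear function of
  \<open>x\<close>, so \<open>half_sq_infdist_lower\<close> applies termwise; nonnegative
  measurements make the balls nonempty.\<close>

lemma cost_subgradient: "cost x + grad x \<bullet> (y - x) \<le> cost y"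
proof -
  have 1: "(\<Sum>(i, j)\<in>edges. 1/2 * (infdist (x $ i - x $ j) (cball 0 (d i j)))\<^sup>2
      + residual (cball 0 (d i j)) (x $ i - x $ j) \<bullet> ((y - x) $ i - (y - x) $ j))
    \<le> (\<Sum>(i, j)\<in>edges. 1/2 * (infdist (y $ i - y $ j) (cball 0 (d i j)))\<^sup>2)"
  proof (rule sum_mono, clarify)
    fix i j assume "adj i j"
    then show "1/2 * (infdist (x $ i - x $ j) (cball 0 (d i j)))\<^sup>2
        + residual (cball 0 (d i j)) (x $ i - x $ j) \<bullet> ((y - x) $ i - (y - x) $ j)
      \<le> 1/2 * (infdist (y $ i - y $ j) (cball 0 (d i j)))\<^sup>2"
      using half_sq_infdist_lower[of "cball 0 (d i j)" "x $ i - x $ j" "y $ i - y $ j"] d_nonneg[of i j]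
      by (simp add: algebra_simps)
  qed
  have 2: "(\<Sum>i\<in>UNIV. \<Sum>k\<in>A i. 1/2 * (infdist (x $ i) (cball (a k) (r i k)))\<^sup>2
      + residual (cball (a k) (r i k)) (x $ i) \<bullet> (y - x) $ i)
    \<le> (\<Sum>i\<in>UNIV. \<Sum>k\<in>A i. 1/2 * (infdist (y $ i) (cball (a k) (r i k)))\<^sup>2)"
  proof (intro sum_mono)
    fix i k assume "k \<in> A i"
    then show "1/2 * (infdist (x $ i) (cball (a k) (r i k)))\<^sup>2
        + residual (cball (a k) (r i k)) (x $ i) \<bullet> (y - x) $ i
      \<le> 1/2 * (infdist (y $ i) (cball (a k) (r i k)))\<^sup>2"
      using half_sq_infdist_lower[of "cball (a k) (r i k)" "x $ i" "y $ i"] r_nonneg[of k i]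
      by simp
  qed
  show ?thesis
    using add_mono[OF 1 2]
    unfolding network_cost_def inner_network_gradient case_prod_beta sum.distrib by linarith
qed

text \<open>The remainder is kept as a sum over edges and anchor links, so that for a displacement
  of one block it can be evaluated by counting.\<close>

lemma cost_upper:
  "cost y \<le> cost x + grad x \<bullet> (y - x)
    + 1/2 * ((\<Sum>(i, j)\<in>edges. (norm ((y - x) $ i - (y - x) $ j))\<^sup>2)
           + (\<Sum>i\<in>UNIV. card (A i) * (norm ((y - x) $ i))\<^sup>2))"
proof -
  have 1: "(\<Sum>(i, j)\<in>edges. 1/2 * (infdist (y $ i - y $ j) (cball 0 (d i j)))\<^sup>2)
    \<le> (\<Sum>(i, j)\<in>edges. 1/2 * (infdist (x $ i - x $ j) (cball 0 (d i j)))\<^sup>2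
      + residual (cball 0 (d i j)) (x $ i - x $ j) \<bullet> ((y - x) $ i - (y - x) $ j)
      + 1/2 * (norm ((y - x) $ i - (y - x) $ j))\<^sup>2)"
  proof (rule sum_mono, clarify)
    fix i j assume "adj i j"
    then show "1/2 * (infdist (y $ i - y $ j) (cball 0 (d i j)))\<^sup>2
      \<le> 1/2 * (infdist (x $ i - x $ j) (cball 0 (d i j)))\<^sup>2
        + residual (cball 0 (d i j)) (x $ i - x $ j) \<bullet> ((y - x) $ i - (y - x) $ j)
        + 1/2 * (norm ((y - x) $ i - (y - x) $ j))\<^sup>2"
      using half_sq_infdist_upper[of "cball 0 (d i j)" "y $ i - y $ j" "x $ i - x $ j"] d_nonneg[of i j]
      by (simp add: algebra_simps)
  qed
  have 2: "(\<Sum>i\<in>UNIV. \<Sum>k\<in>A i. 1/2 * (infdist (y $ i) (cball (a k) (r i k)))\<^sup>2)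
    \<le> (\<Sum>i\<in>UNIV. \<Sum>k\<in>A i. 1/2 * (infdist (x $ i) (cball (a k) (r i k)))\<^sup>2
      + residual (cball (a k) (r i k)) (x $ i) \<bullet> (y - x) $ i + 1/2 * (norm ((y - x) $ i))\<^sup>2)"
  proof (intro sum_mono)
    fix i k assume "k \<in> A i"
    then show "1/2 * (infdist (y $ i) (cball (a k) (r i k)))\<^sup>2
      \<le> 1/2 * (infdist (x $ i) (cball (a k) (r i k)))\<^sup>2
        + residual (cball (a k) (r i k)) (x $ i) \<bullet> (y - x) $ i + 1/2 * (norm ((y - x) $ i))\<^sup>2"
      using half_sq_infdist_upper[of "cball (a k) (r i k)" "y $ i" "x $ i"] r_nonneg[of k i]
      by simp
  qed
  have 3: "(\<Sum>(i, j)\<in>edges. 1/2 * (norm ((y - x) $ i - (y - x) $ j))\<^sup>2)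
    = 1/2 * (\<Sum>(i, j)\<in>edges. (norm ((y - x) $ i - (y - x) $ j))\<^sup>2)"
    unfolding sum_distrib_left case_prod_beta ..
  have 4: "(\<Sum>i\<in>UNIV. \<Sum>k\<in>A i. 1/2 * (norm ((y - x) $ i))\<^sup>2)
    = 1/2 * (\<Sum>i\<in>UNIV. card (A i) * (norm ((y - x) $ i))\<^sup>2)"
    unfolding sum_distrib_left by simp
  show ?thesis
    using add_mono[OF 1 2]
    unfolding network_cost_def inner_network_gradient distrib_left 3[symmetric] 4[symmetric]
      case_prod_beta sum.distrib by (simp only: add_ac)
qed

text \<open>When only block \<open>l\<close> moves, just the edges at \<open>l\<close> and the
  anchors of \<open>l\<close> contribute to the remainder, each with the squared norm of the
  move.\<close>

lemma cost_block_upper: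
  "cost (block_update x l w) \<le> cost x + grad x $ l \<bullet> (w - x $ l)
    + lipschitz_const adj A / 2 * (norm (w - x $ l))\<^sup>2"
proof -
  define u where "u = w - x $ l"
  define y where "y = block_update x l w"
  have y: "(y - x) $ i = (if i = l then u else 0)" for i
    by (simp add: y_def u_def block_update_def)
  have "grad x \<bullet> (y - x) = (\<Sum>i\<in>UNIV. if i = l then grad x $ l \<bullet> u else 0)"
    unfolding inner_vec_def[of "grad x"] by (intro sum.cong) (auto simp: y simp del: vector_minus_component)
  then have lin: "grad x \<bullet> (y - x) = grad x $ l \<bullet> u"
    by simp
  let ?deg = "card {j. adj l j}"
  \<comment> \<open>No edge has \<open>l\<close> at both ends, so the two indicators never hold
    together and the sum of the two terms is exact.\<close>
  have "(\<Sum>(i, j)\<in>edges. (norm ((y - x) $ i - (y - x) $ j))\<^sup>2)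
    = (\<Sum>(i, j)\<in>edges. of_bool (i = l) * (norm u)\<^sup>2 + of_bool (j = l) * (norm u)\<^sup>2)"
    by (intro sum.cong) (auto simp: y simp del: vector_minus_component)
  also have "\<dots> = (\<Sum>e\<in>edges. of_bool (fst e = l) * (norm u)\<^sup>2)
      + (\<Sum>e\<in>edges. of_bool (snd e = l) * (norm u)\<^sup>2)"
    unfolding case_prod_beta by (rule sum.distrib)
  also have "\<dots> = (card {e \<in> edges. fst e = l} + card {e \<in> edges. snd e = l}) * (norm u)\<^sup>2"
  proof -
    have "(\<Sum>e\<in>S. of_bool (Q e) * c) = card {e \<in> S. Q e} * c"
      if "finite S" for S :: "('n \<times> 'n) set" and Q and c :: real
      using that by (simp add: sum_distrib_right[symmetric] Int_def)
    then show ?thesis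
      by (simp only: finite distrib_right of_nat_add)
  qed
  \<comment> \<open>The edges with \<open>l\<close> as smaller end and those with \<open>l\<close>
    as larger end are each bounded by the degree; this is crude, but matches the factor 2 in
    \<open>lipschitz_const\<close>.\<close>
  also have "\<dots> \<le> (?deg + ?deg) * (norm u)\<^sup>2"
  proof -
    have "card {e \<in> edges. fst e = l} \<le> ?deg"
      by (rule card_inj_on_le[where f = snd]) (auto simp: inj_on_def)
    moreover have "card {e \<in> edges. snd e = l} \<le> ?deg"
      by (rule card_inj_on_le[where f = fst]) (auto simp: inj_on_def intro: adj_sym)
    ultimately show ?thesis
      by (intro mult_right_mono) auto
  qed
  finally have quad_edges:
    "(\<Sum>(i, j)\<in>edges. (norm ((y - x) $ i - (y - x) $ j))\<^sup>2) \<le> (?deg + ?deg) * (norm u)\<^sup>2" .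
  have "(\<Sum>i\<in>UNIV. card (A i) * (norm ((y - x) $ i))\<^sup>2)
    = (\<Sum>i\<in>UNIV. if i = l then card (A l) * (norm u)\<^sup>2 else 0)"
    by (intro sum.cong) (auto simp: y simp del: vector_minus_component)
  then have quad_anchors: "(\<Sum>i\<in>UNIV. card (A i) * (norm ((y - x) $ i))\<^sup>2) = card (A l) * (norm u)\<^sup>2"
    by simp
  have "?deg \<le> Max (range (\<lambda>i. card {j. adj i j}))" "card (A l) \<le> Max (range (\<lambda>i. card (A i)))"
    by (auto intro: Max_ge)
  then have "real (2 * ?deg + card (A l)) \<le> lipschitz_const adj A"
    unfolding lipschitz_const_def by (intro of_nat_mono) linarith
  then have "real (2 * ?deg + card (A l)) * (norm u)\<^sup>2 \<le> lipschitz_const adj A * (norm u)\<^sup>2"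
    by (rule mult_right_mono) simp
  then have "(?deg + ?deg) * (norm u)\<^sup>2 + card (A l) * (norm u)\<^sup>2 \<le> lipschitz_const adj A * (norm u)\<^sup>2"
    by (simp add: algebra_simps)
  with quad_edges quad_anchors
  have "(\<Sum>(i, j)\<in>edges. (norm ((y - x) $ i - (y - x) $ j))\<^sup>2)
      + (\<Sum>i\<in>UNIV. card (A i) * (norm ((y - x) $ i))\<^sup>2) \<le> lipschitz_const adj A * (norm u)\<^sup>2"
    by (metis (no_types, lifting) add_right_mono order_trans)
  moreover have "e \<le> b + K/2 * n" if "s \<le> K * n" "e \<le> b + 1/2 * s" for b e n s K :: real
    using that by simp
  ultimately show ?thesis
    using cost_upper[of y x] unfolding lin y_def[symmetric] u_def[symmetric] by blast
qed

lemma cost_nonneg: "0 \<le> cost x"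
  unfolding network_cost_def by (intro add_nonneg_nonneg sum_nonneg) auto

text \<open>The anchor link alone gives positivity, which covers a single sensor without
  edges.\<close>

lemma lipschitz_const_pos: "0 < lipschitz_const adj A"
proof -
  obtain i where "A i \<noteq> {}"
    using anchored by blast
  then have "0 < card (A i)"
    by (simp add: card_gt_0_iff)
  also have "\<dots> \<le> Max (range (\<lambda>i. card (A i)))"
    by (rule Max_ge) auto
  finally show ?thesis
    by (simp add: lipschitz_const_def)
qed

lemma continuous_on_cost: "continuous_on UNIV cost"
  unfolding network_cost_def[abs_def] case_prod_beta by (intro continuous_intros)

lemma continuous_on_grad: "continuous_on UNIV grad"
  unfolding network_gradient_def[abs_def] case_prod_beta
  by (intro continuous_intros) (auto dest: d_nonneg r_nonneg)

section \<open>Boundedness of the sublevel sets of the network cost\<close>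

text \<open>A single term of the cost is at most \<open>R\<close>, so its distance is at most
  \<open>sqrt (2 * R)\<close>. The maximum accounts for either orientation, as the cost lists an
  edge only with its smaller end first.\<close>

lemma norm_edge_le:
  assumes "adj i j" "cost x \<le> R"
  shows "norm (x $ i - x $ j) \<le> sqrt (2 * R) + max (d i j) (d j i)"
proof -
  have *: "norm (x $ i - x $ j) \<le> sqrt (2 * R) + d i j" if e: "(i, j) \<in> edges" for i j
  proof -
    have "1/2 * (infdist (x $ i - x $ j) (cball 0 (d i j)))\<^sup>2
      \<le> (\<Sum>(i, j)\<in>edges. 1/2 * (infdist (x $ i - x $ j) (cball 0 (d i j)))\<^sup>2)"
      using member_le_sum[OF e, of "\<lambda>(i, j). 1/2 * (infdist (x $ i - x $ j) (cball 0 (d i j)))\<^sup>2"]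
      by auto
    also have "\<dots> \<le> cost x"
      unfolding network_cost_def by (simp add: sum_nonneg)
    finally have "infdist (x $ i - x $ j) (cball 0 (d i j)) \<le> sqrt (2 * R)"
      using assms(2) by (intro real_le_rsqrt) simp
    then show ?thesis
      using norm_le_infdist_cball[of "d i j" "x $ i - x $ j" 0] d_nonneg[of i j] e by simp
  qed
  show ?thesis
  proof (cases "i < j")
    case True
    then show ?thesis
      using *[of i j] assms(1) by auto
  next
    case False
    then have "j < i"
      using assms(1) adj_irrefl by (metis linorder_neqE)
    then show ?thesis
      using *[of j i] adj_sym[OF assms(1)] by (auto simp: norm_minus_commute)
  qed
qed

lemma norm_anchored_le:
  assumes "k \<in> A i" "cost x \<le> R"
  shows "norm (x $ i) \<le> sqrt (2 * R) + norm (a k) + r i k"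
proof -
  have "1/2 * (infdist (x $ i) (cball (a k) (r i k)))\<^sup>2
    \<le> (\<Sum>k\<in>A i. 1/2 * (infdist (x $ i) (cball (a k) (r i k)))\<^sup>2)"
    using assms(1) by (intro member_le_sum) auto
  also have "\<dots> \<le> (\<Sum>i\<in>UNIV. \<Sum>k\<in>A i. 1/2 * (infdist (x $ i) (cball (a k) (r i k)))\<^sup>2)"
    by (intro member_le_sum[of i UNIV "\<lambda>i. \<Sum>k\<in>A i. 1/2 * (infdist (x $ i) (cball (a k) (r i k)))\<^sup>2"])
      (auto intro: sum_nonneg)
  also have "\<dots> \<le> cost x"
    unfolding network_cost_def by (auto intro!: sum_nonneg)
  finally have "infdist (x $ i) (cball (a k) (r i k)) \<le> sqrt (2 * R)"
    using assms(2) by (intro real_le_rsqrt) simp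
  then show ?thesis
    using norm_le_infdist_cball[OF r_nonneg[OF assms(1)], of "x $ i" "a k"] by simp
qed

text \<open>
  An anchor confines its sensor, and each edge confines a sensor relative to its neighbour, so
  connectedness confines all of them.
\<close>

lemma bounded_sublevel_cost: "bounded {x. cost x \<le> R}"
proof -
  obtain i0 k0 where "k0 \<in> A i0"
    using anchored by blast
  have "\<exists>B. \<forall>x. cost x \<le> R \<longrightarrow> norm (x $ j) \<le> B" for j
    using connected[of i0 j]
  proof (induction rule: rtranclp_induct)
    case base
    then show ?case
      using norm_anchored_le[OF \<open>k0 \<in> A i0\<close>] by blast
  next
    case (step i j)
    then obtain B where B: "\<And>x. cost x \<le> R \<Longrightarrow> norm (x $ i) \<le> B"
      by blast
    have "norm (x $ j) \<le> B + (sqrt (2 * R) + max (d j i) (d i j))" if "cost x \<le> R" for x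
      using norm_edge_le[OF adj_sym[OF step(2)] that] B[OF that]
        norm_triangle_ineq[of "x $ i" "x $ j - x $ i"] by simp
    then show ?case
      by blast
  qed
  then obtain B where B: "\<And>j x. cost x \<le> R \<Longrightarrow> norm (x $ j) \<le> B j"
    by metis
  have "norm x \<le> (\<Sum>j\<in>UNIV. B j)" if "cost x \<le> R" for x
  proof -
    have "norm x \<le> (\<Sum>j\<in>UNIV. norm (x $ j))"
      unfolding norm_vec_def[of x] by (rule L2_set_le_sum) simp
    also have "\<dots> \<le> (\<Sum>j\<in>UNIV. B j)"
      by (intro sum_mono B[OF that])
    finally show ?thesis .
  qed
  then show ?thesis
    unfolding bounded_iff by blast
qed

sublocale smooth_convex cost grad "lipschitz_const adj A"
  by (rule smooth_convex.intro)
    (rule cost_subgradient cost_block_upper lipschitz_const_pos continuous_on_cost continuous_on_grad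
      cost_nonneg bounded_sublevel_cost)+

end

section \<open>Convergence of both asynchronous algorithms\<close>

theorem theorem2:
  fixes adj :: "'n::{finite,linorder} \<Rightarrow> 'n \<Rightarrow> bool"
    and d :: "'n \<Rightarrow> 'n \<Rightarrow> real"
    and A :: "'n \<Rightarrow> 'm::finite set"
    and a :: "'m \<Rightarrow> real ^ 'p::finite"
    and r :: "'n \<Rightarrow> 'm \<Rightarrow> real"
    and M :: "'w measure"
    and \<xi> :: "nat \<Rightarrow> 'w \<Rightarrow> 'n"
    and P :: "'n \<Rightarrow> real"
    and x :: "nat \<Rightarrow> 'w \<Rightarrow> (real ^ 'p) ^ 'n::{finite,linorder}"
  defines "f \<equiv> network_cost adj d A a r"
    and "L \<equiv> lipschitz_const adj A"
  assumes dim: "CARD('p) = 2 \<or> CARD('p) = 3"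
    and adj_sym: "\<And>i j. adj i j \<Longrightarrow> adj j i"
    and adj_irrefl: "\<And>i. \<not> adj i i"
    and connected: "\<And>i j. adj\<^sup>*\<^sup>* i j"
    and anchored: "\<exists>i. A i \<noteq> {}"
    and d_sym: "\<And>i j. adj i j \<Longrightarrow> d i j = d j i"
    and d_nonneg: "\<And>i j. adj i j \<Longrightarrow> 0 \<le> d i j"
    and r_nonneg: "\<And>i k. k \<in> A i \<Longrightarrow> 0 \<le> r i k"
    and prob: "prob_space M"
    and \<xi>_indep: "prob_space.indep_vars M (\<lambda>_. count_space UNIV) \<xi> {1..}"
    and P_pos: "\<And>i. 0 < P i"
    and \<xi>_distr: "\<And>k i. 1 \<le> k \<Longrightarrow> measure M {\<omega> \<in> space M. \<xi> k \<omega> = i} = P i"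
    and x0_indep: "indep_rvs M borel (x 0)
          (\<Pi>\<^sub>M k\<in>{1..}. count_space UNIV) (\<lambda>\<omega>. \<lambda>k\<in>{1..}. \<xi> k \<omega>)"
    and algorithm: "exact_async M f \<xi> x \<and> nonanticipative M \<xi> x \<or> gradient_async M f L \<xi> x"
  shows "minimizers f \<noteq> {} \<and>
    (AE \<omega> in M. (\<lambda>k. infdist (x k \<omega>) (minimizers f)) \<longlonglongrightarrow> 0)"
proof -
  interpret sensor_network adj d A a r
    by unfold_locales (use adj_sym adj_irrefl connected anchored d_nonneg r_nonneg in auto)
  interpret prob_space M
    by (fact prob)
  have \<xi>_meas: "\<xi> (Suc k) \<in> measurable M (count_space UNIV)" for k
    using \<xi>_indep by (auto simp: indep_vars_def2)
  have upd: "exact_update f (\<xi> (Suc k) \<omega>) (x k \<omega>) (x (Suc k) \<omega>)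
      \<or> gradient_update f L (\<xi> (Suc k) \<omega>) (x k \<omega>) (x (Suc k) \<omega>)" if "\<omega> \<in> space M" for \<omega> k
    using algorithm that unfolding exact_async_def gradient_async_def by blast
  \<comment> \<open>The two algorithms meet here: independence of the next activation is part of
    \<open>nonanticipative\<close> for exact updates, and follows from the recursion for gradient
    steps.\<close>
  have past: "x k \<in> borel_measurable M \<and> (\<forall>T\<in>sets borel. \<forall>i.
      prob ({\<omega> \<in> space M. x k \<omega> \<in> T} \<inter> {\<omega> \<in> space M. \<xi> (Suc k) \<omega> = i})
      = prob {\<omega> \<in> space M. x k \<omega> \<in> T} * prob {\<omega> \<in> space M. \<xi> (Suc k) \<omega> = i})" for k
    using algorithm
  proof
    assume "exact_async M f \<xi> x \<and> nonanticipative M \<xi> x"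
    then show ?thesis
      using nonanticipative_indep_next[OF prob, where \<xi> = \<xi> and x = x and k = k] by simp
  next
    assume grd: "gradient_async M f L \<xi> x"
    \<comment> \<open>The gradient step is a continuous function of the current point once the block
      is fixed, so measurability and independence propagate from \<open>x 0\<close>.\<close>
    define F where "F i y = block_update y i (y $ i - (1 / L) *\<^sub>R grad y $ i)" for i y
    have "continuous_on UNIV (F i)" for i
      unfolding F_def block_update_def
    proof (rule continuous_on_vec_lambda)
      show "continuous_on UNIV (\<lambda>y. if j = i then y $ i - (1 / L) *\<^sub>R grad y $ i else y $ j)" for j
        by (cases "j = i") (auto intro!: continuous_intros cont_G)
    qed
    then have F: "F i \<in> borel_measurable borel" for i
      by (rule borel_measurable_continuous_onI)
    have rec: "\<forall>\<omega>\<in>space M. \<forall>k. x (Suc k) \<omega> = F (\<xi> (Suc k) \<omega>) (x k \<omega>)"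
      using grd gradient_update_eq unfolding gradient_async_def f_def L_def F_def by blast
    note future = iterated_indep_future[where x = x and \<xi> = \<xi> and F = F and k = k,
        OF \<xi>_indep x0_indep F rec]
    have "prob ({\<omega> \<in> space M. x k \<omega> \<in> T} \<inter> {\<omega> \<in> space M. \<xi> (Suc k) \<omega> = i})
      = prob {\<omega> \<in> space M. x k \<omega> \<in> T} * prob {\<omega> \<in> space M. \<xi> (Suc k) \<omega> = i}"
      if "T \<in> sets borel" for T i
    proof -
      \<comment> \<open>Only the next activation is required, so the window is cut down to one
        index.\<close>
      have "{k<..Suc k} = {Suc k}"
        by auto
      then show ?thesis
        using future[THEN conjunct2, THEN bspec, OF that, THEN spec[of _ "\<lambda>_. i"], THEN spec[of _ "Suc k"]]
        by simp
    qed
    with future[THEN conjunct1] show ?thesis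
      by simp
  qed
  have indep: "prob ({\<omega> \<in> space M. x k \<omega> \<in> T} \<inter> {\<omega> \<in> space M. \<xi> (Suc k) \<omega> = i})
      = prob {\<omega> \<in> space M. x k \<omega> \<in> T} * P i" if "T \<in> sets borel" for T i k
    using past[of k] that \<xi>_distr[of "Suc k" i] by simp
  have "AE \<omega> in M. (\<lambda>k. infdist (x k \<omega>) (minimizers f)) \<longlonglongrightarrow> 0"
    unfolding f_def
  proof (rule AE_infdist_minimizers_tendsto_0[where x = x and \<xi> = \<xi> and P = P, OF prob _ \<xi>_meas indep P_pos])
    show "x k \<in> borel_measurable M" for k
      using past by blast
    show "exact_update cost (\<xi> (Suc k) \<omega>) (x k \<omega>) (x (Suc k) \<omega>)
      \<or> gradient_update cost (lipschitz_const adj A) (\<xi> (Suc k) \<omega>) (x k \<omega>) (x (Suc k) \<omega>)"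
      if "\<omega> \<in> space M" for \<omega> k
      using upd[OF that] unfolding f_def L_def .
  qed
  then show ?thesis
    using minimizers_nonempty by (simp add: f_def)
qed

end
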